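(* Let $G$ be a compact, connected, semisimple group of unitary matrices, let $E$ be a finite set, and consider on $(G\times\mathrm{Lie}(G))^{E}$, with coordinates $(h_e,P^e_i)_{e\in E,\,i=1,\dots,\dim G}$, the Poisson bracket $\{\cdot,\cdot\}$ and the function $C=\frac{1}{2\kappa a^{n}}\sum_{e\in E}\delta^{ij}P^e_iP^e_j$ described in the context. Put $p^e_j:=P^e_j/a^{n}$. Then for every $e\in E$ the complexification of $h_e$ generated by $C$, $$h_e^{\mathbb C}:=\sum_{k=0}^\infty \frac{i^k}{k!}\{h_e,C\}_{(k)},$$ is given by $$h_e^{\mathbb C}=e^{-i\tau_jp^e_j/2}\,h_e$$ (sum over $j$). This is a left polar decomposition: the right factor $h_e$ is unitary (an element of $G$) and the left factor $e^{-i\tau_jp^e_j/2}$ is a positive definite Hermitian matrix.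
   Context: $\tau_1,\dots,\tau_{\dim G}$ is a basis of $\mathrm{Lie}(G)$ consisting of anti-Hermitian matrices, normalized by $\mathrm{tr}(\tau_i\tau_j)=-N\delta_{ij}$ with a constant $N>0$, and $[\tau_i,\tau_j]=2f_{ij}{}^k\tau_k$ defines the structure constants. The constants $\kappa,a>0$ and the integer $n$ are fixed. $P^e_i$ are the real components of the $\mathrm{Lie}(G)$-valued coordinate with respect to the basis $\tau_i$. The Poisson bracket is determined by $$\{h_e,h_{e'}\}=0,\quad \{P^e_i/\kappa,\,h_{e'}\}=\delta^e_{e'}\tfrac{\tau_i}{2}h_e,\quad \{P^e_i/\kappa,\,P^{e'}_j/\kappa\}=-\delta^{ee'}f_{ij}{}^kP^e_k/\kappa$$ (brackets of the matrix-valued $h_e$ are taken entrywise). Iterated brackets: $\{F,C\}_{(0)}=F$ and $\{F,C\}_{(k+1)}=\{\{F,C\}_{(k)},C\}$. *)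

theory Defs
  imports "HOL-Analysis.Analysis"
begin

section \<open>Complex matrices\<close>

text \<open>
  On \<open>complex^'m^'m\<close> the library's \<open>*\<close>, \<open>1\<close> and \<open>^\<close> act entrywise, so
  neither \<open>^\<close> nor the library's \<open>exp\<close> is the matrix notion.
\<close>

primrec mat_pow :: "complex^'m^'m \<Rightarrow> nat \<Rightarrow> complex^'m^'m" where
  "mat_pow A 0 = mat 1"
| "mat_pow A (Suc k) = A ** mat_pow A k"

definition mat_exp :: "complex^'m^'m \<Rightarrow> complex^'m^'m" where
  "mat_exp A = (\<Sum>k. mat_pow A k /\<^sub>R fact k)"

definition cscale :: "complex \<Rightarrow> complex^'m^'m \<Rightarrow> complex^'m^'m"  (infixr "*\<^sub>C" 75) where
  "c *\<^sub>C A = map_matrix ((*) c) A"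

definition mat_adj :: "complex^'m^'m \<Rightarrow> complex^'m^'m" where
  "mat_adj A = transpose (map_matrix cnj A)"

definition unitary_mat :: "complex^'m^'m \<Rightarrow> bool" where
  "unitary_mat U \<longleftrightarrow> mat_adj U ** U = mat 1 \<and> U ** mat_adj U = mat 1"

definition pos_def_hermitian :: "complex^'m^'m \<Rightarrow> bool" where
  "pos_def_hermitian A \<longleftrightarrow> mat_adj A = A \<and>
     (\<forall>v. v \<noteq> 0 \<longrightarrow> 0 < Re (\<Sum>r\<in>UNIV. cnj (v $ r) * (A *v v) $ r))"

definition left_polar_decomposition ::
    "complex^'m^'m \<Rightarrow> complex^'m^'m \<Rightarrow> complex^'m^'m \<Rightarrow> bool" where
  "left_polar_decomposition A S U \<longleftrightarrow> A = S ** U \<and> pos_def_hermitian S \<and> unitary_mat U"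


section \<open>Matrix groups and their Lie algebras\<close>

definition unitary_group :: "(complex^'m^'m) set \<Rightarrow> bool" where
  "unitary_group G \<longleftrightarrow> mat 1 \<in> G \<and> (\<forall>A\<in>G. \<forall>B\<in>G. A ** B \<in> G) \<and>
     (\<forall>A\<in>G. matrix_inv A \<in> G) \<and> (\<forall>A\<in>G. unitary_mat A)"

definition lie_algebra :: "(complex^'m^'m) set \<Rightarrow> (complex^'m^'m) set" where
  "lie_algebra G = {X. \<forall>t::real. mat_exp (t *\<^sub>R X) \<in> G}"

definition commutator :: "complex^'m^'m \<Rightarrow> complex^'m^'m \<Rightarrow> complex^'m^'m" where
  "commutator A B = A ** B - B ** A"

definition lie_ideal :: "(complex^'m^'m) set \<Rightarrow> (complex^'m^'m) set \<Rightarrow> bool" where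
  "lie_ideal I L \<longleftrightarrow> subspace I \<and> I \<subseteq> L \<and> (\<forall>A\<in>L. \<forall>B\<in>I. commutator A B \<in> I)"

primrec derived_series :: "(complex^'m^'m) set \<Rightarrow> nat \<Rightarrow> (complex^'m^'m) set" where
  "derived_series L 0 = L"
| "derived_series L (Suc k) =
     span {commutator A B | A B. A \<in> derived_series L k \<and> B \<in> derived_series L k}"

definition solvable_lie_algebra :: "(complex^'m^'m) set \<Rightarrow> bool" where
  "solvable_lie_algebra L \<longleftrightarrow> (\<exists>k. derived_series L k = {0})"

definition semisimple_lie_algebra :: "(complex^'m^'m) set \<Rightarrow> bool" where
  "semisimple_lie_algebra L \<longleftrightarrow> (\<forall>I. lie_ideal I L \<and> solvable_lie_algebra I \<longrightarrow> I = {0})"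


section \<open>Smooth functions and Poisson brackets\<close>

text \<open>\<open>times_diff k f U\<close>: on the open set \<open>U\<close>, \<open>f\<close> is of class \<open>C\<^sup>k\<close>.\<close>

primrec times_diff :: "nat \<Rightarrow> ('a::euclidean_space \<Rightarrow> real) \<Rightarrow> 'a set \<Rightarrow> bool" where
  "times_diff 0 f U \<longleftrightarrow> continuous_on U f"
| "times_diff (Suc k) f U \<longleftrightarrow> (\<forall>x\<in>U. f differentiable (at x)) \<and>
     (\<forall>v. times_diff k (\<lambda>x. frechet_derivative f (at x) v) U)"

text \<open>
  Smooth functions on a subset \<open>M\<close> of a Euclidean space are those that extend, locally around each
  point of \<open>M\<close>, to a smooth function on an open set. If \<open>M\<close> is an embedded submanifold, these are
  the smooth functions of the manifold. Values outside \<open>M\<close> are irrelevant.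
\<close>

definition smooth_fun :: "'a::euclidean_space set \<Rightarrow> ('a \<Rightarrow> real) \<Rightarrow> bool" where
  "smooth_fun M F \<longleftrightarrow> (\<forall>x\<in>M. \<exists>U g. open U \<and> x \<in> U \<and> (\<forall>k. times_diff k g U) \<and>
     (\<forall>y\<in>U \<inter> M. g y = F y))"

locale poisson_bracket =
  fixes M :: "'a::euclidean_space set"
    and pb :: "('a \<Rightarrow> real) \<Rightarrow> ('a \<Rightarrow> real) \<Rightarrow> ('a \<Rightarrow> real)"
  assumes smooth: "smooth_fun M F \<Longrightarrow> smooth_fun M H \<Longrightarrow> smooth_fun M (pb F H)"
    and cong: "smooth_fun M F \<Longrightarrow> smooth_fun M F' \<Longrightarrow> smooth_fun M H \<Longrightarrow>
      (\<And>y. y \<in> M \<Longrightarrow> F y = F' y) \<Longrightarrow> x \<in> M \<Longrightarrow> pb F H x = pb F' H x"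
    and antisym: "smooth_fun M F \<Longrightarrow> smooth_fun M H \<Longrightarrow> x \<in> M \<Longrightarrow> pb F H x = - pb H F x"
    and add: "smooth_fun M F \<Longrightarrow> smooth_fun M F' \<Longrightarrow> smooth_fun M H \<Longrightarrow> x \<in> M \<Longrightarrow>
      pb (\<lambda>y. F y + F' y) H x = pb F H x + pb F' H x"
    and scale: "smooth_fun M F \<Longrightarrow> smooth_fun M H \<Longrightarrow> x \<in> M \<Longrightarrow>
      pb (\<lambda>y. c * F y) H x = c * pb F H x"
    and leibniz: "smooth_fun M F \<Longrightarrow> smooth_fun M F' \<Longrightarrow> smooth_fun M H \<Longrightarrow> x \<in> M \<Longrightarrow>
      pb (\<lambda>y. F y * F' y) H x = F x * pb F' H x + pb F H x * F' x"
    and jacobi: "smooth_fun M F \<Longrightarrow> smooth_fun M H \<Longrightarrow> smooth_fun M K \<Longrightarrow> x \<in> M \<Longrightarrow>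
      pb F (pb H K) x + pb H (pb K F) x + pb K (pb F H) x = 0"

text \<open>The complex bilinear extension to complex-valued functions.\<close>

definition cpb :: "(('a \<Rightarrow> real) \<Rightarrow> ('a \<Rightarrow> real) \<Rightarrow> ('a \<Rightarrow> real)) \<Rightarrow>
    ('a \<Rightarrow> complex) \<Rightarrow> ('a \<Rightarrow> complex) \<Rightarrow> ('a \<Rightarrow> complex)" where
  "cpb pb F H = (\<lambda>x. Complex
     (pb (\<lambda>y. Re (F y)) (\<lambda>y. Re (H y)) x - pb (\<lambda>y. Im (F y)) (\<lambda>y. Im (H y)) x)
     (pb (\<lambda>y. Re (F y)) (\<lambda>y. Im (H y)) x + pb (\<lambda>y. Im (F y)) (\<lambda>y. Re (H y)) x))"

definition mat_pb :: "(('a \<Rightarrow> real) \<Rightarrow> ('a \<Rightarrow> real) \<Rightarrow> ('a \<Rightarrow> real)) \<Rightarrow>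
    ('a \<Rightarrow> complex^'m^'m) \<Rightarrow> ('a \<Rightarrow> real) \<Rightarrow> ('a \<Rightarrow> complex^'m^'m)" where
  "mat_pb pb F C = (\<lambda>x. \<chi> r s. cpb pb (\<lambda>y. F y $ r $ s) (\<lambda>y. complex_of_real (C y)) x)"

primrec iter_pb :: "(('a \<Rightarrow> real) \<Rightarrow> ('a \<Rightarrow> real) \<Rightarrow> ('a \<Rightarrow> real)) \<Rightarrow>
    ('a \<Rightarrow> complex^'m^'m) \<Rightarrow> ('a \<Rightarrow> real) \<Rightarrow> nat \<Rightarrow> ('a \<Rightarrow> complex^'m^'m)" where
  "iter_pb pb F C 0 = F"
| "iter_pb pb F C (Suc k) = mat_pb pb (iter_pb pb F C k) C"

definition complexification_term :: "(('a \<Rightarrow> real) \<Rightarrow> ('a \<Rightarrow> real) \<Rightarrow> ('a \<Rightarrow> real)) \<Rightarrow>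
    ('a \<Rightarrow> complex^'m^'m) \<Rightarrow> ('a \<Rightarrow> real) \<Rightarrow> 'a \<Rightarrow> nat \<Rightarrow> complex^'m^'m" where
  "complexification_term pb F C x k = (\<i> ^ k / fact k) *\<^sub>C iter_pb pb F C k x"

definition complexification :: "(('a \<Rightarrow> real) \<Rightarrow> ('a \<Rightarrow> real) \<Rightarrow> ('a \<Rightarrow> real)) \<Rightarrow>
    ('a \<Rightarrow> complex^'m^'m) \<Rightarrow> ('a \<Rightarrow> real) \<Rightarrow> 'a \<Rightarrow> complex^'m^'m" where
  "complexification pb F C x = (\<Sum>k. complexification_term pb F C x k)"


section \<open>The phase space\<close>

text \<open>
  A point of \<open>(G \<times> Lie(G))\<^sup>E\<close> is stored as a pair of families indexed by \<open>E\<close>, here the finite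
  type \<open>'e\<close>, inside the Euclidean space of all pairs of families of matrices.
\<close>

type_synonym ('m, 'e) phase = "(complex^'m^'m^'e) \<times> (complex^'m^'m^'e)"

definition phase_space :: "(complex^'m^'m) set \<Rightarrow> ('m::finite, 'e::finite) phase set" where
  "phase_space G = {x. \<forall>e. fst x $ e \<in> G \<and> snd x $ e \<in> lie_algebra G}"

definition hol :: "'e::finite \<Rightarrow> ('m::finite, 'e) phase \<Rightarrow> complex^'m^'m" where
  "hol e x = fst x $ e"

text \<open>
  \<open>flux d \<tau> e i\<close> is the component at \<open>\<tau> i\<close> of the Lie-algebra-valued coordinate at \<open>e\<close>
  with respect to the basis \<open>\<tau> 0, \<dots>, \<tau> (d - 1)\<close>.
\<close>

definition flux :: "nat \<Rightarrow> (nat \<Rightarrow> complex^'m^'m) \<Rightarrow> 'e::finite \<Rightarrow> nat \<Rightarrow>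
    ('m::finite, 'e) phase \<Rightarrow> real" where
  "flux d \<tau> e i x = representation (\<tau> ` {..<d}) (snd x $ e) (\<tau> i)"

definition hamiltonian :: "nat \<Rightarrow> (nat \<Rightarrow> complex^'m^'m) \<Rightarrow> real \<Rightarrow> real \<Rightarrow> int \<Rightarrow>
    ('m::finite, 'e::finite) phase \<Rightarrow> real" where
  "hamiltonian d \<tau> \<kappa> a n x =
     1 / (2 * \<kappa> * a powi n) * (\<Sum>e\<in>UNIV. \<Sum>i<d. flux d \<tau> e i x * flux d \<tau> e i x)"

text \<open>
  A Poisson bracket with the prescribed values on the coordinates. These determine it: the
  brackets involving \<open>cnj (h\<^sub>e)\<close> follow because \<open>h\<^sub>e\<close> is unitary and \<open>pb\<close> is real.
\<close>

locale holonomy_flux_bracket = poisson_bracket "phase_space G" pb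
  for G :: "(complex^'m^'m) set"
    and pb :: "(('m, 'e::finite) phase \<Rightarrow> real) \<Rightarrow> (('m, 'e) phase \<Rightarrow> real) \<Rightarrow>
      (('m, 'e) phase \<Rightarrow> real)" +
  fixes d :: nat
    and \<tau> :: "nat \<Rightarrow> complex^'m^'m"
    and f :: "nat \<Rightarrow> nat \<Rightarrow> nat \<Rightarrow> real"
    and \<kappa> :: real
  assumes hol_hol: "x \<in> phase_space G \<Longrightarrow>
      cpb pb (\<lambda>y. hol e y $ r $ s) (\<lambda>y. hol e' y $ r' $ s') x = 0"
    and flux_hol: "x \<in> phase_space G \<Longrightarrow> i < d \<Longrightarrow>
      cpb pb (\<lambda>y. complex_of_real (flux d \<tau> e i y / \<kappa>)) (\<lambda>y. hol e' y $ r $ s) x =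
        (if e = e' then (((1/2) *\<^sub>R \<tau> i) ** hol e x) $ r $ s else 0)"
    and flux_flux: "x \<in> phase_space G \<Longrightarrow> i < d \<Longrightarrow> j < d \<Longrightarrow>
      pb (\<lambda>y. flux d \<tau> e i y / \<kappa>) (\<lambda>y. flux d \<tau> e' j y / \<kappa>) x =
        - (if e = e' then (\<Sum>k<d. f i j k * flux d \<tau> e k x / \<kappa>) else 0)"

end

theory Submission
  imports Defs
begin

text \<open>
  The trace form turns the structure constants into a totally antisymmetric tensor, so every flux
  Poisson commutes with the quadratic function \<open>C\<close>, while bracketing \<open>h\<^sub>e\<close> with \<open>C\<close>
  multiplies it on the left by \<open>A = - \<tau>\<^sub>j p\<^sub>j / 2\<close>. By the Leibniz rule the iterated brackets are
  \<open>A\<^sup>k h\<^sub>e\<close>, and the series sums to \<open>exp (\<i> A) h\<^sub>e\<close>. As \<open>\<i> A\<close> is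
  Hermitian, \<open>exp (\<i> A)\<close> is the square of the invertible Hermitian matrix
  \<open>exp (\<i> A / 2)\<close>, hence positive definite.
\<close>

section \<open>Smooth functions\<close>

lemma times_diff_Suc_imp: "times_diff (Suc k) f U \<Longrightarrow> times_diff k f U"
proof (induction k arbitrary: f)
  case 0
  then show ?case
    by (auto intro!: continuous_at_imp_continuous_on differentiable_imp_continuous_within)
next
  case (Suc k)
  then show ?case by (metis times_diff.simps(2))
qed

lemma times_diff_subset: "times_diff k f U \<Longrightarrow> V \<subseteq> U \<Longrightarrow> times_diff k f V"
  by (induction k arbitrary: f) (auto intro: continuous_on_subset)

text \<open>Openness of \<open>U\<close> turns agreement on \<open>U\<close> into agreement near
  each of its points, so the Frechet derivatives coincide there and the induction hypothesis applies
  to them. This lets a derivative be replaced by the formula that a differentiation rule gives for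
  it.\<close>

lemma times_diff_cong:
  assumes "open U"
  shows "times_diff k f U \<Longrightarrow> (\<And>x. x \<in> U \<Longrightarrow> f x = g x) \<Longrightarrow> times_diff k g U"
proof (induction k arbitrary: f g)
  case 0
  then show ?case by (simp cong: continuous_on_cong)
next
  case (Suc k)
  have der: "(g has_derivative frechet_derivative f (at x)) (at x)" if "x \<in> U" for x
    using Suc.prems that assms
    by (auto intro: has_derivative_transform_within_open simp: frechet_derivative_works)
  have eq: "frechet_derivative f (at x) = frechet_derivative g (at x)" if "x \<in> U" for x
    using der[OF that] by (rule frechet_derivative_at)
  have "times_diff k (\<lambda>x. frechet_derivative g (at x) v) U" for v
    by (rule Suc.IH[of "\<lambda>x. frechet_derivative f (at x) v"]) (use Suc.prems(1) in \<open>simp_all add: eq\<close>)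
  then show ?case using der by (auto simp: differentiable_def)
qed

lemma times_diff_const: "times_diff k (\<lambda>x. c) U"
  by (induction k arbitrary: c) auto

lemma times_diff_bounded_linear:
  assumes "bounded_linear f"
  shows "times_diff k f U"
proof (cases k)
  case 0
  then show ?thesis using assms by (simp add: linear_continuous_on)
next
  case (Suc j)
  have "frechet_derivative f (at x) = f" for x
    using bounded_linear_imp_has_derivative[OF assms] by (rule frechet_derivative_at[symmetric])
  then show ?thesis
    using Suc assms by (simp add: times_diff_const bounded_linear_imp_differentiable)
qed

lemma times_diff_add:
  assumes "open U"
  shows "times_diff k f U \<Longrightarrow> times_diff k g U \<Longrightarrow> times_diff k (\<lambda>x. f x + g x) U"
proof (induction k arbitrary: f g)
  case 0
  then show ?case by (simp add: continuous_on_add)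
next
  case (Suc k)
  have der: "((\<lambda>x. f x + g x) has_derivative
      (\<lambda>v. frechet_derivative f (at x) v + frechet_derivative g (at x) v)) (at x)"
    if "x \<in> U" for x
    using Suc.prems that by (intro has_derivative_add) (auto simp: frechet_derivative_works)
  have "times_diff k (\<lambda>x. frechet_derivative (\<lambda>x. f x + g x) (at x) v) U" for v
  proof (rule times_diff_cong[OF assms])
    show "times_diff k (\<lambda>x. frechet_derivative f (at x) v + frechet_derivative g (at x) v) U"
      using Suc by simp
  qed (simp add: frechet_derivative_at[OF der, symmetric])
  then show ?case using Suc.prems by simp
qed

lemma times_diff_mult:
  assumes "open U"
  shows "times_diff k f U \<Longrightarrow> times_diff k g U \<Longrightarrow> times_diff k (\<lambda>x. f x * g x) U"
proof (induction k arbitrary: f g)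
  case 0
  then show ?case by (simp add: continuous_on_mult)
next
  case (Suc k)
  have der: "((\<lambda>x. f x * g x) has_derivative
      (\<lambda>v. f x * frechet_derivative g (at x) v + frechet_derivative f (at x) v * g x)) (at x)"
    if "x \<in> U" for x
    using Suc.prems that by (intro has_derivative_mult) (auto simp: frechet_derivative_works)
  have "times_diff k (\<lambda>x. frechet_derivative (\<lambda>x. f x * g x) (at x) v) U" for v
  proof (rule times_diff_cong[OF assms])
    show "times_diff k
        (\<lambda>x. f x * frechet_derivative g (at x) v + frechet_derivative f (at x) v * g x) U"
      \<comment> \<open>The product rule keeps the undifferentiated factors \<open>f\<close> and
        \<open>g\<close>; that these are C^k follows from their being C^(k+1).\<close>
      using Suc.prems times_diff_Suc_imp[of k] by (intro times_diff_add[OF assms] Suc.IH) auto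
  qed (simp add: frechet_derivative_at[OF der, symmetric])
  then show ?case using der by (auto simp: differentiable_def)
qed

section \<open>Smooth functions on a subset of a Euclidean space\<close>

lemma smooth_fun_cong:
  assumes "smooth_fun M F" "\<And>x. x \<in> M \<Longrightarrow> F x = H x"
  shows "smooth_fun M H"
  using assms unfolding smooth_fun_def by (metis IntD2)

lemma smooth_fun_global:
  assumes "\<And>k. times_diff k F UNIV"
  shows "smooth_fun M F"
  using assms unfolding smooth_fun_def by blast

lemma smooth_fun_const: "smooth_fun M (\<lambda>x. c)"
  by (intro smooth_fun_global times_diff_const)

lemma smooth_fun_linear: "linear F \<Longrightarrow> smooth_fun M F"
  by (intro smooth_fun_global times_diff_bounded_linear) (simp add: linear_conv_bounded_linear)

text \<open>The local extensions of \<open>F\<close> and \<open>H\<close> may live on different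
  neighbourhoods of a point; on the intersection both are available. Sum and product share this
  argument.\<close>

lemma smooth_fun_binop:
  fixes F H :: "'a::euclidean_space \<Rightarrow> real"
  assumes "smooth_fun M F" "smooth_fun M H"
    and op: "\<And>(U :: 'a set) k f g. open U \<Longrightarrow> times_diff k f U \<Longrightarrow> times_diff k g U \<Longrightarrow>
      times_diff k (\<lambda>x. b (f x) (g x)) U"
  shows "smooth_fun M (\<lambda>x. b (F x) (H x))"
  unfolding smooth_fun_def
proof
  fix x assume "x \<in> M"
  then obtain U f V g where
    U: "open U" "x \<in> U" "\<forall>k. times_diff k f U" "\<forall>y\<in>U \<inter> M. f y = F y" and
    V: "open V" "x \<in> V" "\<forall>k. times_diff k g V" "\<forall>y\<in>V \<inter> M. g y = H y"
    using assms(1,2) unfolding smooth_fun_def by meson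
  have "times_diff k (\<lambda>y. b (f y) (g y)) (U \<inter> V)" for k
    using U V by (intro op[of "U \<inter> V"]) (auto intro: times_diff_subset)
  then show "\<exists>U g. open U \<and> x \<in> U \<and> (\<forall>k. times_diff k g U) \<and> (\<forall>y\<in>U \<inter> M. g y = b (F y) (H y))"
    using U V by (intro exI[of _ "U \<inter> V"] exI[of _ "\<lambda>y. b (f y) (g y)"]) auto
qed

lemma smooth_fun_add: "smooth_fun M F \<Longrightarrow> smooth_fun M H \<Longrightarrow> smooth_fun M (\<lambda>x. F x + H x)"
  by (rule smooth_fun_binop[where b = "(+)"]) (auto intro: times_diff_add)

lemma smooth_fun_mult: "smooth_fun M F \<Longrightarrow> smooth_fun M H \<Longrightarrow> smooth_fun M (\<lambda>x. F x * H x)"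
  by (rule smooth_fun_binop[where b = "(*)"]) (auto intro: times_diff_mult)

lemma smooth_fun_diff: "smooth_fun M F \<Longrightarrow> smooth_fun M H \<Longrightarrow> smooth_fun M (\<lambda>x. F x - H x)"
  using smooth_fun_add[OF _ smooth_fun_mult[OF smooth_fun_const[of M "-1"]], of F H] by simp

lemma smooth_fun_divide: "smooth_fun M F \<Longrightarrow> smooth_fun M (\<lambda>x. F x / c)"
  using smooth_fun_mult[OF _ smooth_fun_const[of M "1 / c"], of F] by simp

lemma smooth_fun_sum:
  assumes "\<And>i. i \<in> I \<Longrightarrow> smooth_fun M (F i)"
  shows "smooth_fun M (\<lambda>x. \<Sum>i\<in>I. F i x)"
  using assms
  by (induction I rule: infinite_finite_induct) (simp_all add: smooth_fun_const smooth_fun_add)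

text \<open>Splitting into real and imaginary parts matches \<open>cpb\<close>, whose value is
  assembled from real brackets of these parts.\<close>

definition smooth_cfun :: "'a::euclidean_space set \<Rightarrow> ('a \<Rightarrow> complex) \<Rightarrow> bool" where
  "smooth_cfun M F \<longleftrightarrow> smooth_fun M (\<lambda>x. Re (F x)) \<and> smooth_fun M (\<lambda>x. Im (F x))"

lemma smooth_cfun_of_real:
  "smooth_fun M F \<Longrightarrow> smooth_cfun M (\<lambda>x. complex_of_real (F x))"
  by (simp add: smooth_cfun_def smooth_fun_const)

lemma smooth_cfun_const: "smooth_cfun M (\<lambda>x. c)"
  by (simp add: smooth_cfun_def smooth_fun_const)

lemma smooth_cfun_mult:
  "smooth_cfun M F \<Longrightarrow> smooth_cfun M H \<Longrightarrow> smooth_cfun M (\<lambda>x. F x * H x)"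
  by (simp add: smooth_cfun_def smooth_fun_mult smooth_fun_add smooth_fun_diff)

lemma smooth_cfun_sum:
  "(\<And>i. i \<in> I \<Longrightarrow> smooth_cfun M (F i)) \<Longrightarrow> smooth_cfun M (\<lambda>x. \<Sum>i\<in>I. F i x)"
  by (simp add: smooth_cfun_def smooth_fun_sum)

section \<open>Poisson brackets as derivations\<close>

context poisson_bracket
begin

text \<open>Agreement on \<open>M\<close> transfers smoothness from \<open>F\<close> to
  \<open>F'\<close>, which discharges one hypothesis of \<open>cong\<close>.\<close>

lemma pb_cong:
  assumes "smooth_fun M F" "smooth_fun M H" "\<And>y. y \<in> M \<Longrightarrow> F y = F' y" "x \<in> M"
  shows "pb F H x = pb F' H x"
  using assms by (metis cong smooth_fun_cong)

lemma pb_zero_left: "smooth_fun M H \<Longrightarrow> x \<in> M \<Longrightarrow> pb (\<lambda>y. 0) H x = 0"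
  using scale[of "\<lambda>y. 0" H x 0] by (simp add: smooth_fun_const)

lemma pb_zero_right: "smooth_fun M F \<Longrightarrow> x \<in> M \<Longrightarrow> pb F (\<lambda>y. 0) x = 0"
  using antisym[of F "\<lambda>y. 0" x] by (simp add: smooth_fun_const pb_zero_left)

lemma pb_sum_left:
  assumes "\<And>i. i \<in> I \<Longrightarrow> smooth_fun M (F i)" "smooth_fun M H" "x \<in> M"
  shows "pb (\<lambda>y. \<Sum>i\<in>I. F i y) H x = (\<Sum>i\<in>I. pb (F i) H x)"
  using assms(1)
  by (induction I rule: infinite_finite_induct)
    (simp_all add: assms(2,3) pb_zero_left add smooth_fun_sum)

lemma pb_diff_left:
  assumes "smooth_fun M F" "smooth_fun M F'" "smooth_fun M H" "x \<in> M"
  shows "pb (\<lambda>y. F y - F' y) H x = pb F H x - pb F' H x"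
proof -
  have "smooth_fun M (\<lambda>y. - 1 * F' y)"
    using assms by (intro smooth_fun_mult smooth_fun_const)
  with add[OF assms(1) this assms(3,4)] scale[OF assms(2,3,4), of "- 1"] show ?thesis
    by simp
qed

text \<open>A real argument has imaginary part zero, so two of the four real brackets in
  \<open>cpb\<close> vanish.\<close>

lemma cpb_of_real_left:
  assumes "smooth_fun M F" "smooth_cfun M H" "x \<in> M"
  shows "cpb pb (\<lambda>y. complex_of_real (F y)) H x =
    Complex (pb F (\<lambda>y. Re (H y)) x) (pb F (\<lambda>y. Im (H y)) x)"
  using assms by (simp add: cpb_def smooth_cfun_def pb_zero_left)

lemma cpb_of_real_right:
  assumes "smooth_cfun M F" "smooth_fun M H" "x \<in> M"
  shows "cpb pb F (\<lambda>y. complex_of_real (H y)) x =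
    Complex (pb (\<lambda>y. Re (F y)) H x) (pb (\<lambda>y. Im (F y)) H x)"
  using assms by (simp add: cpb_def smooth_cfun_def pb_zero_right)

lemma cpb_cong:
  assumes "smooth_cfun M F" "smooth_fun M H" "\<And>y. y \<in> M \<Longrightarrow> F y = F' y" "x \<in> M"
  shows "cpb pb F (\<lambda>y. complex_of_real (H y)) x = cpb pb F' (\<lambda>y. complex_of_real (H y)) x"
proof -
  have F': "smooth_cfun M F'"
    using assms(1,3) unfolding smooth_cfun_def by (auto elim: smooth_fun_cong)
  have "pb (\<lambda>y. Re (F y)) H x = pb (\<lambda>y. Re (F' y)) H x"
    "pb (\<lambda>y. Im (F y)) H x = pb (\<lambda>y. Im (F' y)) H x"
    using assms by (auto intro!: pb_cong simp: smooth_cfun_def)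
  then show ?thesis
    using assms F' by (simp add: cpb_of_real_right)
qed

lemma cpb_const:
  assumes "smooth_fun M H" "x \<in> M"
  shows "cpb pb (\<lambda>y. c) (\<lambda>y. complex_of_real (H y)) x = 0"
proof -
  have "pb (\<lambda>y. r) H x = 0" for r
  proof -
    \<comment> \<open>The Leibniz rule for 1 = 1 * 1 gives {1, H} = 2 {1, H}; homogeneity then
      covers all constants.\<close>
    have "pb (\<lambda>y. 1) H x = 0"
      using leibniz[of "\<lambda>y. 1" "\<lambda>y. 1" H x] assms by (simp add: smooth_fun_const)
    then show ?thesis
      using scale[of "\<lambda>y. 1" H x r] assms by (simp add: smooth_fun_const)
  qed
  then show ?thesis
    using assms by (simp add: cpb_of_real_right smooth_cfun_const complex_eq_iff)
qed

text \<open>With \<open>H\<close> real, the identity splits into the real Leibniz rule for the four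
  products of real and imaginary parts.\<close>

lemma cpb_mult:
  assumes "smooth_cfun M F" "smooth_cfun M F'" "smooth_fun M H" "x \<in> M"
  shows "cpb pb (\<lambda>y. F y * F' y) (\<lambda>y. complex_of_real (H y)) x =
    F x * cpb pb F' (\<lambda>y. complex_of_real (H y)) x + cpb pb F (\<lambda>y. complex_of_real (H y)) x * F' x"
  using assms
  by (simp add: cpb_of_real_right smooth_cfun_mult)
    (simp add: smooth_cfun_def complex_eq_iff pb_diff_left add leibniz smooth_fun_mult algebra_simps)

lemma cpb_sum:
  assumes "\<And>i. i \<in> I \<Longrightarrow> smooth_cfun M (F i)" "smooth_fun M H" "x \<in> M"
  shows "cpb pb (\<lambda>y. \<Sum>i\<in>I. F i y) (\<lambda>y. complex_of_real (H y)) x =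
    (\<Sum>i\<in>I. cpb pb (F i) (\<lambda>y. complex_of_real (H y)) x)"
  using assms
  by (simp add: cpb_of_real_right smooth_cfun_sum)
    (simp add: smooth_cfun_def complex_eq_iff pb_sum_left)

end

section \<open>The matrix exponential\<close>

lemma matrix_mult_scaleR:
  fixes A B :: "complex^'m::finite^'m"
  shows "(c *\<^sub>R A) ** B = c *\<^sub>R (A ** B)" "A ** (c *\<^sub>R B) = c *\<^sub>R (A ** B)"
  by (simp_all add: vec_eq_iff matrix_matrix_mult_def scaleR_sum_right)

lemma matrix_add_rdistrib:
  fixes A B C :: "complex^'m::finite^'m"
  shows "(A + B) ** C = A ** C + B ** C"
  by (simp add: vec_eq_iff matrix_matrix_mult_def distrib_right sum.distrib)

text \<open>Finite dimension makes every bilinear map bounded. This supplies the norm estimate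
  behind the exponential series and lets multiplication by a fixed matrix pass through infinite
  sums.\<close>

lemma bounded_bilinear_matrix_mult:
  "bounded_bilinear ((**) :: complex^'m::finite^'m \<Rightarrow> complex^'m^'m \<Rightarrow> complex^'m^'m)"
  unfolding bilinear_conv_bounded_bilinear[symmetric] bilinear_def
  by (auto intro!: linearI simp: matrix_mult_scaleR matrix_add_ldistrib matrix_add_rdistrib)

lemma cscale_nth [simp]: "(c *\<^sub>C A) $ r $ s = c * A $ r $ s"
  by (simp add: cscale_def map_matrix_def)

lemma mat_adj_nth [simp]: "mat_adj A $ r $ s = cnj (A $ s $ r)"
  by (simp add: mat_adj_def map_matrix_def transpose_def)

lemma mat_adj_mult: "mat_adj (A ** B) = mat_adj B ** mat_adj (A :: complex^'m::finite^'m)"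
  by (simp add: vec_eq_iff matrix_matrix_mult_def mult.commute)

lemma mat_adj_mat1: "mat_adj (mat 1) = (mat 1 :: complex^'m::finite^'m)"
  by (simp add: vec_eq_iff mat_def)

lemma mat_pow_commute: "mat_pow A k ** A = A ** mat_pow (A :: complex^'m::finite^'m) k"
  by (induction k) (simp_all add: matrix_mul_assoc[symmetric])

lemma mat_pow_add: "mat_pow A (j + k) = mat_pow A j ** mat_pow (A :: complex^'m::finite^'m) k"
  by (induction j) (simp_all add: matrix_mul_assoc)

lemma mat_pow_scaleR: "mat_pow (c *\<^sub>R A) k = c ^ k *\<^sub>R mat_pow (A :: complex^'m::finite^'m) k"
  by (induction k) (simp_all add: matrix_mult_scaleR mult.commute)

lemma cscale_mult:
  fixes A B :: "complex^'m::finite^'m"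
  shows "(c *\<^sub>C A) ** B = c *\<^sub>C (A ** B)" "A ** (c *\<^sub>C B) = c *\<^sub>C (A ** B)"
  by (simp_all add: vec_eq_iff matrix_matrix_mult_def sum_distrib_left mult_ac)

lemma mat_pow_cscale: "mat_pow (c *\<^sub>C A) k = c ^ k *\<^sub>C mat_pow (A :: complex^'m::finite^'m) k"
  by (induction k) (simp_all add: cscale_mult, simp_all add: vec_eq_iff mult_ac)

lemma mat_pow_hermitian:
  "mat_adj A = A \<Longrightarrow> mat_adj (mat_pow A k) = mat_pow (A :: complex^'m::finite^'m) k"
  by (induction k) (simp_all add: mat_adj_mult mat_adj_mat1 mat_pow_commute)

text \<open>With a bound \<open>K\<close> for the bilinear product, the norm of the k-th power is at
  most \<open>(K * norm A) ^ k * norm (mat 1)\<close>, so the scalar exponential series of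
  \<open>K * norm A\<close> dominates.\<close>

lemma mat_exp_summable_norm:
  fixes A :: "complex^'m::finite^'m"
  shows "summable (\<lambda>k. norm (mat_pow A k /\<^sub>R fact k))"
proof -
  have "\<exists>K>0. \<forall>(A :: complex^'m^'m) (B :: complex^'m^'m). norm (A ** B) \<le> norm A * norm B * K"
    by (rule bounded_bilinear.pos_bounded[OF bounded_bilinear_matrix_mult])
  then obtain K where K: "K > 0" "\<And>(A :: complex^'m^'m) (B :: complex^'m^'m). norm (A ** B) \<le> norm A * norm B * K"
    by blast
  have bound: "norm (mat_pow A k) \<le> (K * norm A) ^ k * norm (mat 1 :: complex^'m^'m)" for k
  proof (induction k)
    case (Suc k)
    have "norm (mat_pow A (Suc k)) \<le> K * norm A * norm (mat_pow A k)"
      using K(2)[of A "mat_pow A k"] by (simp add: mult_ac)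
    also have "\<dots> \<le> K * norm A * ((K * norm A) ^ k * norm (mat 1 :: complex^'m^'m))"
      using Suc K(1) by (intro mult_left_mono) auto
    finally show ?case by (simp add: mult_ac)
  qed simp
  have "summable (\<lambda>k. (K * norm A) ^ k /\<^sub>R fact k * norm (mat 1 :: complex^'m^'m))"
    by (intro summable_mult2 summable_exp_generic)
  then show ?thesis
  proof (rule summable_comparison_test')
    show "norm (norm (mat_pow A k /\<^sub>R fact k)) \<le>
        (K * norm A) ^ k /\<^sub>R fact k * norm (mat 1 :: complex^'m^'m)" for k
      using bound[of k] by (simp add: field_simps)
  qed
qed

lemma mat_exp_sums: "(\<lambda>k. mat_pow A k /\<^sub>R fact k) sums mat_exp (A :: complex^'m::finite^'m)"
  unfolding mat_exp_def by (rule summable_sums[OF summable_norm_cancel[OF mat_exp_summable_norm]])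

lemma mat_exp_nth_sums:
  "(\<lambda>k. (mat_pow A k /\<^sub>R fact k) $ r $ s) sums (mat_exp (A :: complex^'m::finite^'m) $ r $ s)"
  by (rule bounded_linear.sums[OF bounded_linear_compose[OF bounded_linear_vec_nth bounded_linear_vec_nth]
      mat_exp_sums])

lemma mat_exp_nth_summable_norm:
  "summable (\<lambda>k. norm ((mat_pow A k /\<^sub>R fact k :: complex^'m::finite^'m) $ r $ s))"
proof (rule summable_comparison_test'[OF mat_exp_summable_norm])
  fix k
  show "norm (norm ((mat_pow A k /\<^sub>R fact k) $ r $ s)) \<le> norm (mat_pow A k /\<^sub>R fact k)"
    using order_trans[OF Finite_Cartesian_Product.norm_nth_le Finite_Cartesian_Product.norm_nth_le]
    by simp
qed

text \<open>
  There is no Banach algebra instance for these matrices, so the Cauchy product is taken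
  entry by entry.
\<close>

lemma mat_exp_add_scaleR:
  fixes A :: "complex^'m::finite^'m"
  shows "mat_exp (s *\<^sub>R A) ** mat_exp (t *\<^sub>R A) = mat_exp ((s + t) *\<^sub>R A)"
proof -
  \<comment> \<open>This is the binomial theorem divided by k!.\<close>
  have coeff: "(\<Sum>i\<le>k. (s ^ i / fact i) * (t ^ (k - i) / fact (k - i))) = (s + t) ^ k / fact k" for k
  proof -
    have "(\<Sum>i\<le>k. (s ^ i / fact i) * (t ^ (k - i) / fact (k - i))) * fact k =
        (\<Sum>i\<le>k. of_nat (k choose i) * s ^ i * t ^ (k - i))"
      unfolding sum_distrib_right by (intro sum.cong refl) (simp add: binomial_fact field_simps)
    then show ?thesis by (simp add: binomial_ring field_simps)
  qed
  let ?a = "\<lambda>i. mat_pow (s *\<^sub>R A) i /\<^sub>R fact i" and ?b = "\<lambda>i. mat_pow (t *\<^sub>R A) i /\<^sub>R fact i"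
  \<comment> \<open>Both factors are multiples of powers of the same \<open>A\<close>, so every
    summand is a multiple of the k-th power and only scalar coefficients have to be added.\<close>
  have conv: "(\<Sum>i\<le>k. ?a i ** ?b (k - i)) = mat_pow ((s + t) *\<^sub>R A) k /\<^sub>R fact k" for k
  proof -
    have "?a i ** ?b (k - i) = ((s ^ i / fact i) * (t ^ (k - i) / fact (k - i))) *\<^sub>R mat_pow A k"
      if "i \<le> k" for i
      using mat_pow_add[of A i "k - i"] that
      by (simp add: mat_pow_scaleR matrix_mult_scaleR divide_inverse mult_ac)
    then have "(\<Sum>i\<le>k. ?a i ** ?b (k - i)) =
        (\<Sum>i\<le>k. (s ^ i / fact i) * (t ^ (k - i) / fact (k - i))) *\<^sub>R mat_pow A k"
      by (simp add: scaleR_sum_left)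
    then show ?thesis
      unfolding coeff by (simp add: mat_pow_scaleR divide_inverse mult_ac)
  qed
  have "(mat_exp (s *\<^sub>R A) ** mat_exp (t *\<^sub>R A)) $ p $ q = mat_exp ((s + t) *\<^sub>R A) $ p $ q" for p q
  proof (rule sums_unique2)
    have "(\<lambda>k. \<Sum>i\<le>k. ?a i $ p $ u * ?b (k - i) $ u $ q) sums
        (mat_exp (s *\<^sub>R A) $ p $ u * mat_exp (t *\<^sub>R A) $ u $ q)" for u
      using Cauchy_product_sums[OF mat_exp_nth_summable_norm mat_exp_nth_summable_norm]
      by (simp only: sums_unique[OF mat_exp_nth_sums, symmetric])
    then have "(\<lambda>k. \<Sum>u\<in>UNIV. \<Sum>i\<le>k. ?a i $ p $ u * ?b (k - i) $ u $ q) sums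
        (mat_exp (s *\<^sub>R A) ** mat_exp (t *\<^sub>R A)) $ p $ q"
      unfolding matrix_matrix_mult_def by (simp add: sums_sum)
    also have "(\<lambda>k. \<Sum>u\<in>UNIV. \<Sum>i\<le>k. ?a i $ p $ u * ?b (k - i) $ u $ q) =
        (\<lambda>k. (\<Sum>i\<le>k. ?a i ** ?b (k - i)) $ p $ q)"
      unfolding matrix_matrix_mult_def sum_component by (subst sum.swap) simp
    finally show "(\<lambda>k. (mat_pow ((s + t) *\<^sub>R A) k /\<^sub>R fact k) $ p $ q) sums
        (mat_exp (s *\<^sub>R A) ** mat_exp (t *\<^sub>R A)) $ p $ q"
      by (simp only: conv)
  qed (rule mat_exp_nth_sums)
  then show ?thesis by (simp add: vec_eq_iff)
qed

lemma mat_exp_zero: "mat_exp 0 = (mat 1 :: complex^'m::finite^'m)"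
proof -
  have "mat_pow (0 :: complex^'m^'m) k /\<^sub>R fact k = (if k = 0 then mat 1 else 0)" for k
    by (cases k) simp_all
  then show ?thesis
    using sums_unique2[OF mat_exp_sums[of "0 :: complex^'m^'m"], of "mat 1"]
      sums_single[of 0 "\<lambda>k. mat 1 :: complex^'m^'m"]
    by simp
qed

text \<open>All powers of \<open>A\<close> are Hermitian, so conjugation carries the series of the
  entry (s, r) term by term to that of (r, s), and the limits agree.\<close>

lemma mat_adj_mat_exp:
  fixes A :: "complex^'m::finite^'m"
  assumes "mat_adj A = A"
  shows "mat_adj (mat_exp A) = mat_exp A"
proof -
  have "mat_adj (mat_exp A) $ r $ s = mat_exp A $ r $ s" for r s
  proof (rule sums_unique2)
    have "cnj ((mat_pow A k /\<^sub>R fact k) $ s $ r) = (mat_pow A k /\<^sub>R fact k) $ r $ s" for k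
      using arg_cong[OF mat_pow_hermitian[OF assms, of k], of "\<lambda>B. B $ r $ s"] by simp
    with mat_exp_nth_sums[of A s r, THEN sums_cnj[THEN iffD2]]
    show "(\<lambda>k. (mat_pow A k /\<^sub>R fact k) $ r $ s) sums mat_adj (mat_exp A) $ r $ s"
      by (simp only: mat_adj_nth)
  qed (rule mat_exp_nth_sums)
  then show ?thesis by (simp add: vec_eq_iff)
qed

text \<open>With \<open>T = exp (A / 2)\<close> Hermitian and invertible, the quadratic form of \<open>exp A\<close> at
  \<open>v\<close> is the squared norm of \<open>T v\<close>.\<close>

lemma pos_def_hermitian_mat_exp:
  fixes A :: "complex^'m::finite^'m"
  assumes "mat_adj A = A"
  shows "pos_def_hermitian (mat_exp A)"
  unfolding pos_def_hermitian_def
proof (intro conjI allI impI)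
  show "mat_adj (mat_exp A) = mat_exp A"
    using assms by (rule mat_adj_mat_exp)
next
  fix v :: "complex^'m" assume "v \<noteq> 0"
  define T where "T = mat_exp ((1/2) *\<^sub>R A)"
  define w where "w = T *v v"
  have TT: "mat_exp A = T ** T"
    using mat_exp_add_scaleR[of "1/2" A "1/2"] by (simp add: T_def)
  \<comment> \<open>The inverse exp (-A/2) recovers \<open>v\<close> from \<open>w\<close>; hence
    \<open>w\<close> is nonzero and its squared norm strictly positive.\<close>
  have "mat_exp ((- 1/2) *\<^sub>R A) ** T = mat 1"
    using mat_exp_add_scaleR[of "- 1/2" A "1/2"] by (simp add: T_def mat_exp_zero)
  then have "mat_exp ((- 1/2) *\<^sub>R A) *v w = v"
    unfolding w_def by (simp add: matrix_vector_mul_assoc)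
  with \<open>v \<noteq> 0\<close> have "w \<noteq> 0" by auto
  have "mat_adj ((1/2) *\<^sub>R A) = (1/2) *\<^sub>R A"
    using assms by (auto simp: vec_eq_iff)
  then have "mat_adj T = T"
    unfolding T_def by (rule mat_adj_mat_exp)
  then have T: "T $ r $ s = cnj (T $ s $ r)" for r s
    by (metis mat_adj_nth)
  have "(\<Sum>r\<in>UNIV. cnj (v $ r) * (mat_exp A *v v) $ r) =
      (\<Sum>r\<in>UNIV. \<Sum>s\<in>UNIV. cnj (v $ r) * (T $ r $ s * w $ s))"
    unfolding TT w_def matrix_vector_mul_assoc[symmetric]
    by (simp add: matrix_vector_mult_def[of T "T *v v"] sum_distrib_left)
  also have "\<dots> = (\<Sum>s\<in>UNIV. \<Sum>r\<in>UNIV. cnj (v $ r) * (T $ r $ s * w $ s))"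
    by (rule sum.swap)
  also have "\<dots> = (\<Sum>s\<in>UNIV. cnj (w $ s) * w $ s)"
  proof (rule sum.cong[OF refl])
    fix s
    \<comment> \<open>Being Hermitian, \<open>T\<close> moves across the form to the conjugated
      \<open>v\<close>, where it produces the conjugate of \<open>w\<close>.\<close>
    have "cnj (w $ s) = (\<Sum>r\<in>UNIV. T $ r $ s * cnj (v $ r))"
      unfolding w_def matrix_vector_mult_def by (simp add: T[symmetric])
    then show "(\<Sum>r\<in>UNIV. cnj (v $ r) * (T $ r $ s * w $ s)) = cnj (w $ s) * w $ s"
      by (simp add: sum_distrib_left sum_distrib_right mult_ac)
  qed
  also have "Re \<dots> = (\<Sum>s\<in>UNIV. (cmod (w $ s))\<^sup>2)"
    unfolding Re_sum by (intro sum.cong refl) (simp only: cmod_power2, simp add: power2_eq_square)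
  also have "\<dots> > 0"
  proof -
    obtain s where "w $ s \<noteq> 0" using \<open>w \<noteq> 0\<close> by (auto simp: vec_eq_iff)
    then show ?thesis by (intro sum_pos2[of _ s]) auto
  qed
  finally show "0 < Re (\<Sum>r\<in>UNIV. cnj (v $ r) * (mat_exp A *v v) $ r)" .
qed

section \<open>Holonomies and fluxes\<close>

lemma trace_sum: "trace (\<Sum>i\<in>I. A i) = (\<Sum>i\<in>I. trace (A i :: complex^'m::finite^'m))"
  unfolding trace_def sum_component by (rule sum.swap)

lemma trace_scaleR: "trace (c *\<^sub>R A) = c *\<^sub>R trace (A :: complex^'m::finite^'m)"
  by (simp add: trace_def scaleR_sum_right)

lemma matrix_mult_sum_right:
  fixes A :: "complex^'m::finite^'m" and B :: "'i \<Rightarrow> complex^'m^'m"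
  shows "A ** (\<Sum>i\<in>I. B i) = (\<Sum>i\<in>I. A ** B i)"
  by (rule linear_sum[OF bounded_linear.linear[OF
        bounded_bilinear.bounded_linear_right[OF bounded_bilinear_matrix_mult]]])

lemma matrix_mult_sum_left:
  fixes A :: "complex^'m::finite^'m" and B :: "'i \<Rightarrow> complex^'m^'m"
  shows "(\<Sum>i\<in>I. B i) ** A = (\<Sum>i\<in>I. B i ** A)"
  by (rule linear_sum[OF bounded_linear.linear[OF
        bounded_bilinear.bounded_linear_left[OF bounded_bilinear_matrix_mult]]])

text \<open>Joins the bracket with a trace-orthogonal anti-Hermitian basis and its structure
  constants, so that all computations share one context; the theorem enters it by
  interpretation.\<close>

locale normalized_holonomy_flux = holonomy_flux_bracket G pb d \<tau> f \<kappa>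
  for G :: "(complex^'m::finite^'m) set"
    and pb :: "(('m, 'e::finite) phase \<Rightarrow> real) \<Rightarrow> (('m, 'e) phase \<Rightarrow> real) \<Rightarrow>
      (('m, 'e) phase \<Rightarrow> real)"
    and d :: nat and \<tau> :: "nat \<Rightarrow> complex^'m^'m" and f :: "nat \<Rightarrow> nat \<Rightarrow> nat \<Rightarrow> real"
    and \<kappa> :: real +
  fixes N a :: real and n :: int
  assumes inj_basis: "inj_on \<tau> {..<d}" and independent_basis: "independent (\<tau> ` {..<d})"
    and span_basis: "span (\<tau> ` {..<d}) = lie_algebra G"
    and antihermitian: "i < d \<Longrightarrow> mat_adj (\<tau> i) = - \<tau> i"
    and N_pos: "N > 0"
    and trace_basis: "i < d \<Longrightarrow> j < d \<Longrightarrow>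
      trace (\<tau> i ** \<tau> j) = - complex_of_real N * (if i = j then 1 else 0)"
    and structure_constants: "i < d \<Longrightarrow> j < d \<Longrightarrow>
      commutator (\<tau> i) (\<tau> j) = (\<Sum>k<d. (2 * f i j k) *\<^sub>R \<tau> k)"
    and \<kappa>_pos: "\<kappa> > 0"
begin

abbreviation "M \<equiv> phase_space G :: ('m, 'e) phase set"

abbreviation P :: "'e \<Rightarrow> nat \<Rightarrow> ('m, 'e) phase \<Rightarrow> real" where
  "P \<equiv> flux d \<tau>"

abbreviation C :: "('m, 'e) phase \<Rightarrow> real" where
  "C \<equiv> hamiltonian d \<tau> \<kappa> a n"

text \<open>The basis is orthogonal for the trace form, so pairing with \<open>\<tau> i\<close>
  extracts the i-th coefficient. While \<open>representation\<close> is zero off the span, the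
  right-hand side is linear on the whole ambient space and thus serves as a smooth extension of the
  flux.\<close>

lemma flux_eq_trace:
  assumes "x \<in> M" "i < d"
  shows "P e i x = - Re (trace (\<tau> i ** (snd x $ e))) / N"
proof -
  let ?r = "representation (\<tau> ` {..<d}) (snd x $ e)"
  have "snd x $ e \<in> span (\<tau> ` {..<d})"
    using assms(1) by (simp add: phase_space_def span_basis)
  then have "snd x $ e = (\<Sum>b\<in>\<tau> ` {..<d}. ?r b *\<^sub>R b)"
    by (intro real_vector.sum_representation_eq[symmetric] independent_basis) auto
  also have "\<dots> = (\<Sum>j<d. ?r (\<tau> j) *\<^sub>R \<tau> j)"
    using inj_basis by (simp add: sum.reindex)
  finally have "trace (\<tau> i ** (snd x $ e)) = trace (\<tau> i ** (\<Sum>j<d. ?r (\<tau> j) *\<^sub>R \<tau> j))"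
    by (rule arg_cong)
  also have "\<dots> = (\<Sum>j<d. ?r (\<tau> j) *\<^sub>R trace (\<tau> i ** \<tau> j))"
    by (simp add: matrix_mult_sum_right trace_sum matrix_mult_scaleR trace_scaleR)
  also have "\<dots> = (\<Sum>j<d. if i = j then - of_real (?r (\<tau> j) * N) else 0)"
    using assms(2) by (intro sum.cong) (auto simp: trace_basis scaleR_conv_of_real)
  also have "\<dots> = - of_real (?r (\<tau> i) * N)"
    using assms(2) by simp
  finally show ?thesis
    using N_pos by (simp add: flux_def)
qed

lemma smooth_flux:
  assumes "i < d"
  shows "smooth_fun M (P e i)"
proof (rule smooth_fun_cong)
  show "smooth_fun M (\<lambda>x. - Re (trace (\<tau> i ** (snd x $ e))) / N)"
  proof (rule smooth_fun_linear, rule linearI)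
    show "- Re (trace (\<tau> i ** snd (x + y) $ e)) / N =
        - Re (trace (\<tau> i ** snd x $ e)) / N + - Re (trace (\<tau> i ** snd y $ e)) / N"
      for x y :: "('m, 'e) phase"
      by (simp add: matrix_add_ldistrib trace_add diff_divide_distrib)
    show "- Re (trace (\<tau> i ** snd (c *\<^sub>R x) $ e)) / N =
        c *\<^sub>R (- Re (trace (\<tau> i ** snd x $ e)) / N)"
      for c and x :: "('m, 'e) phase"
      by (simp add: matrix_mult_scaleR trace_scaleR)
  qed
qed (use assms in \<open>simp add: flux_eq_trace\<close>)

lemma smooth_hol: "smooth_cfun M (\<lambda>y. hol e y $ r $ s)"
  unfolding smooth_cfun_def
  by (intro conjI smooth_fun_linear linearI) (simp_all add: hol_def)

lemma smooth_hamiltonian: "smooth_fun M C"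
  unfolding hamiltonian_def
  by (intro smooth_fun_mult smooth_fun_const smooth_fun_sum smooth_flux) auto

section \<open>Symmetries of the structure constants\<close>

lemma structure_constants_trace:
  assumes "i < d" "j < d" "k < d"
  shows "Re (trace (commutator (\<tau> i) (\<tau> j) ** \<tau> k)) = - 2 * N * f i j k"
proof -
  have "trace (commutator (\<tau> i) (\<tau> j) ** \<tau> k) =
      (\<Sum>l<d. (2 * f i j l) *\<^sub>R trace (\<tau> l ** \<tau> k))"
    by (simp add: structure_constants assms matrix_mult_sum_left trace_sum
        matrix_mult_scaleR trace_scaleR)
  also have "\<dots> = (\<Sum>l<d. if l = k then - of_real (2 * N * f i j k) else 0)"
    using assms by (intro sum.cong) (auto simp: trace_basis scaleR_conv_of_real)
  finally show ?thesis using assms by simp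
qed

text \<open>\<open>structure_constants_trace\<close> lowers the last index of \<open>f\<close> with
  the trace form. Cyclicity of the trace then exchanges the two terms of the commutator, which gives
  the sign.\<close>

lemma structure_constants_antisym:
  assumes "i < d" "j < d" "k < d"
  shows "f i k j = - f i j k"
proof -
  have comm: "trace (commutator A B ** D) = trace (A ** B ** D) - trace (B ** A ** D)"
    for A B D :: "complex^'m^'m"
    by (simp add: commutator_def bounded_bilinear.diff_left[OF bounded_bilinear_matrix_mult] trace_sub)
  have "trace (\<tau> i ** \<tau> k ** \<tau> j) = trace (\<tau> j ** \<tau> i ** \<tau> k)"
    "trace (\<tau> k ** \<tau> i ** \<tau> j) = trace (\<tau> i ** \<tau> j ** \<tau> k)"
    by (metis trace_mul_sym matrix_mul_assoc)+
  then have "trace (commutator (\<tau> i) (\<tau> k) ** \<tau> j) = - trace (commutator (\<tau> i) (\<tau> j) ** \<tau> k)"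
    by (simp add: comm)
  from arg_cong[OF this, of Re] have "N * f i k j = N * (- f i j k)"
    unfolding uminus_complex.sel structure_constants_trace[OF assms]
      structure_constants_trace[OF assms(1,3,2)] by linarith
  then show ?thesis
    by (metis N_pos mult_cancel_left less_irrefl)
qed

section \<open>Brackets with the Hamiltonian\<close>

lemma pb_flux:
  assumes "smooth_fun M K" "x \<in> M" "j < d"
  shows "pb (P e j) K x = \<kappa> * pb (\<lambda>y. P e j y / \<kappa>) K x"
  using scale[OF smooth_fun_divide[OF smooth_flux[OF assms(3)]] assms(1,2), of \<kappa> e \<kappa>] \<kappa>_pos
  by simp

text \<open>The Leibniz rule on each square gives a factor 2, and passing to
  \<open>P e j y / \<kappa>\<close> a factor \<kappa>; together they cancel against the prefactor of
  \<open>C\<close>. The function \<open>K\<close> is later a rescaled flux or the real or imaginary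
  part of a holonomy entry.\<close>

lemma pb_hamiltonian:
  assumes K: "smooth_fun M K" and x: "x \<in> M"
  shows "pb C K x = (\<Sum>e\<in>UNIV. \<Sum>j<d. P e j x * pb (\<lambda>y. P e j y / \<kappa>) K x) / a powi n"
proof -
  have sq: "smooth_fun M (\<lambda>y. P e j y * P e j y)" if "j < d" for e j
    using that by (intro smooth_fun_mult smooth_flux)
  then have sqs: "smooth_fun M (\<lambda>y. \<Sum>j<d. P e j y * P e j y)" for e
    by (intro smooth_fun_sum) simp
  have "pb C K x = 1 / (2 * \<kappa> * a powi n) *
      pb (\<lambda>y. \<Sum>e\<in>UNIV. \<Sum>j<d. P e j y * P e j y) K x"
    unfolding hamiltonian_def by (intro scale smooth_fun_sum sqs assms)
  also have "pb (\<lambda>y. \<Sum>e\<in>UNIV. \<Sum>j<d. P e j y * P e j y) K x =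
      (\<Sum>e\<in>UNIV. \<Sum>j<d. pb (\<lambda>y. P e j y * P e j y) K x)"
    by (simp add: pb_sum_left sqs assms) (intro sum.cong refl pb_sum_left, simp_all add: sq assms)
  also have "\<dots> = (\<Sum>e\<in>UNIV. \<Sum>j<d. 2 * \<kappa> * (P e j x * pb (\<lambda>y. P e j y / \<kappa>) K x))"
    by (intro sum.cong refl) (simp add: leibniz assms pb_flux smooth_flux)
  also have "\<dots> = 2 * \<kappa> * (\<Sum>e\<in>UNIV. \<Sum>j<d. P e j x * pb (\<lambda>y. P e j y / \<kappa>) K x)"
    by (simp add: sum_distrib_left)
  finally show ?thesis
    using \<kappa>_pos by simp
qed

text \<open>The bracket is a multiple of the contraction of \<open>f j i k\<close>, antisymmetric in
  j and k, with the symmetric product of the fluxes j and k, hence zero: fluxes are constants of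
  motion.\<close>

lemma pb_flux_hamiltonian:
  assumes "x \<in> M" "i < d"
  shows "pb (P e i) C x = 0"
proof -
  note sm = smooth_fun_divide[OF smooth_flux]
  let ?S = "\<Sum>j<d. \<Sum>k<d. f j i k * (P e j x * P e k x)"
  have swap: "f j i k = - f i j k" if "j < d" "k < d" for j k
  proof -
    have "commutator (\<tau> j) (\<tau> i) ** \<tau> k = - (commutator (\<tau> i) (\<tau> j) ** \<tau> k)"
      by (simp add: commutator_def bounded_bilinear.diff_left[OF bounded_bilinear_matrix_mult])
    then have "Re (trace (commutator (\<tau> j) (\<tau> i) ** \<tau> k)) =
        - Re (trace (commutator (\<tau> i) (\<tau> j) ** \<tau> k))"
      by (simp add: trace_def sum_negf)
    then have "N * f j i k = N * (- f i j k)"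
      unfolding structure_constants_trace[OF that(1) assms(2) that(2)]
        structure_constants_trace[OF assms(2) that] by linarith
    then show ?thesis
      by (metis N_pos mult_cancel_left less_irrefl)
  qed
  \<comment> \<open>Antisymmetry in the outer indices is composed from that in the first two and
    that in the last two.\<close>
  have f_cyc: "f j i k = - f k i j" if "j < d" "k < d" for j k
    using swap[OF that] swap[OF that(2,1)] structure_constants_antisym[OF assms(2) that] by linarith
  \<comment> \<open>Exchanging the names of j and k turns the sum into its own negative.\<close>
  have "?S = (\<Sum>j<d. \<Sum>k<d. - (f k i j * (P e k x * P e j x)))"
    by (intro sum.cong refl) (subst f_cyc, auto)
  also have "\<dots> = - ?S"
    by (subst sum.swap) (simp add: sum_negf)
  finally have S: "?S = 0" by simp
  let ?X = "\<lambda>j. - (\<Sum>k<d. f j i k * (P e j x * P e k x)) / \<kappa>"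
  \<comment> \<open>Fluxes on different edges commute, so the sum over edges collapses to
    \<open>e\<close>.\<close>
  have summand: "P e' j x * pb (\<lambda>y. P e' j y / \<kappa>) (\<lambda>y. P e i y / \<kappa>) x =
      (if e' = e then ?X j else 0)" if "j < d" for e' j
    using that assms by (simp add: flux_flux sum_distrib_left sum_divide_distrib mult_ac)
  have "pb C (\<lambda>y. P e i y / \<kappa>) x =
      (\<Sum>e'\<in>UNIV. \<Sum>j<d. P e' j x * pb (\<lambda>y. P e' j y / \<kappa>) (\<lambda>y. P e i y / \<kappa>) x) / a powi n"
    by (intro pb_hamiltonian sm assms)
  also have "(\<Sum>e'\<in>UNIV. \<Sum>j<d. P e' j x * pb (\<lambda>y. P e' j y / \<kappa>) (\<lambda>y. P e i y / \<kappa>) x) =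
      (\<Sum>e'\<in>UNIV. \<Sum>j<d. if e' = e then ?X j else 0)"
    by (intro sum.cong refl summand) simp
  also have "\<dots> = (\<Sum>j<d. ?X j)"
    by (subst sum.swap) simp
  also have "\<dots> / a powi n = - ?S / \<kappa> / a powi n"
    by (simp add: sum_divide_distrib sum_negf)
  finally have "pb C (\<lambda>y. P e i y / \<kappa>) x = 0"
    using S by simp
  then show ?thesis
    using assms antisym[OF sm[OF assms(2)] smooth_hamiltonian assms(1), of e \<kappa>]
    by (simp add: pb_flux smooth_hamiltonian)
qed

section \<open>The generator of the holonomy flow\<close>

definition generator :: "'e \<Rightarrow> ('m, 'e) phase \<Rightarrow> complex^'m^'m" where
  "generator e x = (\<Sum>j<d. (- (P e j x / a powi n) / 2) *\<^sub>R \<tau> j)"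

text \<open>Each summand becomes a real flux times a complex constant, the shape to which
  \<open>cpb_mult\<close> and \<open>cpb_const\<close> apply.\<close>

lemma generator_nth:
  "generator e x $ r $ s = (\<Sum>j<d. of_real (P e j x) * (of_real (- 1 / (2 * a powi n)) * \<tau> j $ r $ s))"
  by (simp add: generator_def scaleR_conv_of_real[where 'a = complex] mult_ac)

lemma smooth_generator: "smooth_cfun M (\<lambda>y. generator e y $ r $ s)"
  unfolding generator_nth
  by (intro smooth_cfun_sum smooth_cfun_mult smooth_cfun_const smooth_cfun_of_real smooth_flux) simp

lemma cpb_generator:
  assumes "x \<in> M"
  shows "cpb pb (\<lambda>y. generator e y $ r $ s) (\<lambda>y. complex_of_real (C y)) x = 0"
proof -
  have "cpb pb (\<lambda>y. complex_of_real (P e j y)) (\<lambda>y. complex_of_real (C y)) x = 0" if "j < d" for j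
    using that assms
    by (simp add: cpb_of_real_left smooth_flux smooth_cfun_of_real smooth_hamiltonian
        pb_flux_hamiltonian pb_zero_right complex_eq_iff)
  then have summand: "cpb pb (\<lambda>y. complex_of_real (P e j y) * c) (\<lambda>y. complex_of_real (C y)) x = 0"
    if "j < d" for j c
    using that assms
    by (subst cpb_mult)
      (simp_all add: smooth_flux smooth_cfun_of_real smooth_cfun_const smooth_hamiltonian cpb_const)
  show ?thesis
    unfolding generator_nth
  proof (subst cpb_sum)
    show "(\<Sum>j<d. cpb pb
        (\<lambda>y. complex_of_real (P e j y) * (complex_of_real (- 1 / (2 * a powi n)) * \<tau> j $ r $ s))
        (\<lambda>y. complex_of_real (C y)) x) = 0"
      by (intro sum.neutral ballI summand) simp
  next
    show "smooth_cfun M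
        (\<lambda>y. complex_of_real (P e j y) * (complex_of_real (- 1 / (2 * a powi n)) * \<tau> j $ r $ s))"
      if "j \<in> {..<d}" for j
      using that
      by (intro smooth_cfun_mult smooth_cfun_of_real smooth_cfun_const smooth_flux) simp
  qed (intro smooth_hamiltonian assms refl)+
qed

text \<open>Moving \<open>C\<close> to the left slot costs a minus sign,
  \<open>pb_hamiltonian\<close> supplies the flux over \<open>a powi n\<close>, and
  \<open>flux_hol\<close> the factor \<tau>_j / 2 on the edge \<open>e\<close> alone. Together they
  make up \<open>generator e x\<close>.\<close>

lemma cpb_hol:
  assumes x: "x \<in> M"
  shows "cpb pb (\<lambda>y. hol e y $ r $ s) (\<lambda>y. complex_of_real (C y)) x =
    (generator e x ** hol e x) $ r $ s"
proof -
  let ?h = "\<lambda>y. hol e y $ r $ s"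
  let ?T = "\<lambda>e' j. if e' = e then (((1/2) *\<^sub>R \<tau> j) ** hol e x) $ r $ s else 0"
  have Re: "smooth_fun M (\<lambda>y. Re (?h y))" and Im: "smooth_fun M (\<lambda>y. Im (?h y))"
    using smooth_hol unfolding smooth_cfun_def by auto
  \<comment> \<open>\<open>flux_hol\<close> is an equation of complex numbers; its real and
    imaginary parts give the real brackets that occur in \<open>pb_hamiltonian\<close>.\<close>
  have TT: "Complex (pb (\<lambda>y. P e' j y / \<kappa>) (\<lambda>y. Re (?h y)) x) (pb (\<lambda>y. P e' j y / \<kappa>) (\<lambda>y. Im (?h y)) x)
      = ?T e' j" if "j < d" for e' j
    using flux_hol[OF x that, of e' e r s]
      cpb_of_real_left[OF smooth_fun_divide[OF smooth_flux[OF that]] smooth_hol x]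
    by simp
  have T: "pb (\<lambda>y. P e' j y / \<kappa>) (\<lambda>y. Re (?h y)) x = Re (?T e' j)"
      "pb (\<lambda>y. P e' j y / \<kappa>) (\<lambda>y. Im (?h y)) x = Im (?T e' j)" if "j < d" for e' j
    by (simp_all only: TT[OF that, symmetric] complex.sel)
  have "cpb pb ?h (\<lambda>y. complex_of_real (C y)) x =
      - Complex (pb C (\<lambda>y. Re (?h y)) x) (pb C (\<lambda>y. Im (?h y)) x)"
    using x Re Im antisym[OF Re smooth_hamiltonian x] antisym[OF Im smooth_hamiltonian x]
    by (simp add: cpb_of_real_right smooth_hol smooth_hamiltonian complex_eq_iff)
  also have "\<dots> = - (\<Sum>e'\<in>UNIV. \<Sum>j<d. of_real (P e' j x) * ?T e' j) / of_real (a powi n)"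
    using x Re Im by (simp add: pb_hamiltonian T complex_eq_iff Re_divide_of_real Im_divide_of_real
        if_distrib cong: if_cong del: of_real_power_int)
  also have "(\<Sum>e'\<in>UNIV. \<Sum>j<d. of_real (P e' j x) * ?T e' j) =
      (\<Sum>e'\<in>UNIV. if e' = e then \<Sum>j<d. of_real (P e j x) * ?T e j else 0)"
    by (intro sum.cong refl) simp
  also have "\<dots> = (\<Sum>j<d. of_real (P e j x) * (((1/2) *\<^sub>R \<tau> j) ** hol e x) $ r $ s)"
    by simp
  also have "- \<dots> / of_real (a powi n) = (generator e x ** hol e x) $ r $ s"
  proof -
    have "generator e x ** hol e x = (\<Sum>j<d. (- (P e j x / a powi n) / 2) *\<^sub>R (\<tau> j ** hol e x))"
      by (simp only: generator_def matrix_mult_sum_left matrix_mult_scaleR)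
    then show ?thesis
      by (simp add: matrix_mult_scaleR sum_divide_distrib sum_negf
          scaleR_conv_of_real[where 'a = complex] mult_ac)
  qed
  finally show ?thesis .
qed

section \<open>Iterated brackets of a holonomy\<close>

lemma smooth_matrix_product:
  assumes "\<And>r s. smooth_cfun M (\<lambda>y. A y $ r $ s)" "\<And>r s. smooth_cfun M (\<lambda>y. B y $ r $ s)"
  shows "smooth_cfun M (\<lambda>y. (A y ** (B y :: complex^'m^'m)) $ r $ s)"
  unfolding matrix_matrix_mult_def using assms by (simp add: smooth_cfun_sum smooth_cfun_mult)

lemma smooth_generator_pow:
  "smooth_cfun M (\<lambda>y. (mat_pow (generator e y) k ** hol e y) $ r $ s)"
proof (induction k arbitrary: r s)
  case 0
  then show ?case by (simp add: smooth_hol)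
next
  case (Suc k)
  show ?case
    using smooth_matrix_product[OF smooth_generator Suc] by (simp add: matrix_mul_assoc)
qed

text \<open>The generator Poisson commutes with \<open>C\<close>, so the Leibniz rule differentiates
  only the last factor, the holonomy, which contributes one further generator.\<close>

lemma cpb_generator_pow:
  assumes x: "x \<in> M"
  shows "cpb pb (\<lambda>y. (mat_pow (generator e y) k ** hol e y) $ r $ s) (\<lambda>y. complex_of_real (C y)) x =
    (mat_pow (generator e x) (Suc k) ** hol e x) $ r $ s"
proof (induction k arbitrary: r s)
  case 0
  then show ?case by (simp add: cpb_hol x)
next
  case (Suc k)
  let ?Q = "\<lambda>k y. mat_pow (generator e y) k ** hol e y"
  \<comment> \<open>Since \<open>cpb\<close> acts on scalars, the leading generator is split off as
    a sum over entries.\<close>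
  have Q: "?Q (Suc k) y $ r $ s = (\<Sum>t\<in>UNIV. generator e y $ r $ t * ?Q k y $ t $ s)" for k y r s
    unfolding mat_pow.simps matrix_mul_assoc[symmetric]
    by (simp add: matrix_matrix_mult_def[of "generator e y"])
  have "cpb pb (\<lambda>y. ?Q (Suc k) y $ r $ s) (\<lambda>y. complex_of_real (C y)) x =
      (\<Sum>t\<in>UNIV. cpb pb (\<lambda>y. generator e y $ r $ t * ?Q k y $ t $ s) (\<lambda>y. complex_of_real (C y)) x)"
    unfolding Q
    by (intro cpb_sum smooth_cfun_mult smooth_generator smooth_generator_pow smooth_hamiltonian x)
  also have "\<dots> = (\<Sum>t\<in>UNIV. generator e x $ r $ t * ?Q (Suc k) x $ t $ s)"
    by (intro sum.cong refl, subst cpb_mult)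
      (simp_all only: smooth_generator smooth_generator_pow smooth_hamiltonian x
        cpb_generator Suc mult_zero_left add_0_right)
  also have "\<dots> = ?Q (Suc (Suc k)) x $ r $ s"
    by (rule Q[symmetric])
  finally show ?case .
qed

lemma iter_pb_hol:
  "x \<in> M \<Longrightarrow> iter_pb pb (hol e) C k x = mat_pow (generator e x) k ** hol e x"
proof (induction k arbitrary: x)
  case (Suc k)
  have "cpb pb (\<lambda>y. iter_pb pb (hol e) C k y $ r $ s) (\<lambda>y. complex_of_real (C y)) x =
      (mat_pow (generator e x) (Suc k) ** hol e x) $ r $ s" for r s
  proof -
    have "cpb pb (\<lambda>y. (mat_pow (generator e y) k ** hol e y) $ r $ s) (\<lambda>y. complex_of_real (C y)) x =
        cpb pb (\<lambda>y. iter_pb pb (hol e) C k y $ r $ s) (\<lambda>y. complex_of_real (C y)) x"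
      \<comment> \<open>The induction hypothesis identifies the two functions on \<open>M\<close>,
        which is the agreement that \<open>cpb_cong\<close> asks for.\<close>
      by (rule cpb_cong[OF smooth_generator_pow smooth_hamiltonian _ Suc.prems])
        (simp only: Suc.IH)
    then show ?thesis
      by (simp only: cpb_generator_pow[OF Suc.prems])
  qed
  then show ?case by (simp add: mat_pb_def vec_eq_iff)
qed simp

text \<open>The k-th power of \<i> is absorbed into the power of \<i> times the generator, and right
  multiplication by the holonomy is bounded linear, so it passes through the exponential
  series.\<close>

lemma complexification_sums:
  assumes "x \<in> M"
  shows "complexification_term pb (hol e) C x sums (mat_exp (\<i> *\<^sub>C generator e x) ** hol e x)"
proof -
  have "complexification_term pb (hol e) C x =
      (\<lambda>k. (mat_pow (\<i> *\<^sub>C generator e x) k /\<^sub>R fact k) ** hol e x)"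
    using assms
    by (intro ext) (simp add: complexification_term_def iter_pb_hol mat_pow_cscale matrix_mult_scaleR
        cscale_mult vec_eq_iff scaleR_conv_of_real[where 'a = complex] divide_inverse mult_ac)
  then show ?thesis
    using bounded_linear.sums[OF bounded_bilinear.bounded_linear_left[OF bounded_bilinear_matrix_mult]
        mat_exp_sums] by simp
qed

text \<open>A real combination of anti-Hermitian matrices is anti-Hermitian, and \<i> times such a
  matrix is Hermitian.\<close>

lemma hermitian_generator: "mat_adj (\<i> *\<^sub>C generator e x) = \<i> *\<^sub>C generator e x"
proof -
  have "cnj (\<tau> j $ s $ r) = - \<tau> j $ r $ s" if "j < d" for j r s
    using arg_cong[OF antihermitian[OF that], of "\<lambda>A. A $ r $ s"] by simp
  then show ?thesis
    by (simp add: vec_eq_iff generator_def sum_negf cong: sum.cong_simp)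
qed

end

theorem lemma3p1:
  fixes G :: "(complex^'m::finite^'m) set"
    and \<tau> :: "nat \<Rightarrow> complex^'m^'m"
    and d :: nat
    and f :: "nat \<Rightarrow> nat \<Rightarrow> nat \<Rightarrow> real"
    and N \<kappa> a :: real
    and n :: int
    and pb :: "(('m, 'e::finite) phase \<Rightarrow> real) \<Rightarrow> (('m, 'e) phase \<Rightarrow> real) \<Rightarrow>
      (('m, 'e) phase \<Rightarrow> real)"
  assumes "unitary_group G" "compact G" "connected G"
    and "semisimple_lie_algebra (lie_algebra G)"
    and "d = dim (lie_algebra G)"
    and "inj_on \<tau> {..<d}" "independent (\<tau> ` {..<d})" "span (\<tau> ` {..<d}) = lie_algebra G"
    and "\<And>i. i < d \<Longrightarrow> mat_adj (\<tau> i) = - \<tau> i"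
    and "N > 0"
    and "\<And>i j. i < d \<Longrightarrow> j < d \<Longrightarrow>
      trace (\<tau> i ** \<tau> j) = - complex_of_real N * (if i = j then 1 else 0)"
    and "\<And>i j. i < d \<Longrightarrow> j < d \<Longrightarrow>
      commutator (\<tau> i) (\<tau> j) = (\<Sum>k<d. (2 * f i j k) *\<^sub>R \<tau> k)"
    and "\<kappa> > 0" "a > 0"
    and "holonomy_flux_bracket G pb d \<tau> f \<kappa>"
  shows "\<forall>e. \<forall>x \<in> phase_space G.
    (let p = (\<lambda>j. flux d \<tau> e j x / a powi n);
         C = hamiltonian d \<tau> \<kappa> a n;
         S = mat_exp (- ((\<i> / 2) *\<^sub>C (\<Sum>j<d. p j *\<^sub>R \<tau> j)))
     in summable (complexification_term pb (hol e) C x) \<and>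
        complexification pb (hol e) C x = S ** hol e x \<and>
        hol e x \<in> G \<and>
        left_polar_decomposition (complexification pb (hol e) C x) S (hol e x))"
proof (intro allI ballI)
  fix e and x :: "('m, 'e) phase"
  assume x: "x \<in> phase_space G"
  interpret holonomy_flux_bracket G pb d \<tau> f \<kappa> by fact
  interpret normalized_holonomy_flux G pb d \<tau> f \<kappa> N a n
    by unfold_locales (fact assms)+
  \<comment> \<open>The minus sign and the factor 1/2 are already part of \<open>generator\<close>;
    the left factor is thereby the exponential of a Hermitian matrix.\<close>
  have gen: "- ((\<i> / 2) *\<^sub>C (\<Sum>j<d. (flux d \<tau> e j x / a powi n) *\<^sub>R \<tau> j)) = \<i> *\<^sub>C generator e x"
    by (simp add: generator_def vec_eq_iff sum_negf sum_distrib_left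
        scaleR_conv_of_real[where 'a = complex] mult_ac)
  have "hol e x \<in> G"
    using x by (simp add: phase_space_def hol_def)
  moreover from this have "unitary_mat (hol e x)"
    using assms(1) by (simp add: unitary_group_def)
  moreover have "complexification pb (hol e) C x = mat_exp (\<i> *\<^sub>C generator e x) ** hol e x"
    unfolding complexification_def using complexification_sums[OF x] by (rule sums_unique[symmetric])
  ultimately show "let p = (\<lambda>j. flux d \<tau> e j x / a powi n);
         C = hamiltonian d \<tau> \<kappa> a n;
         S = mat_exp (- ((\<i> / 2) *\<^sub>C (\<Sum>j<d. p j *\<^sub>R \<tau> j)))
     in summable (complexification_term pb (hol e) C x) \<and>
        complexification pb (hol e) C x = S ** hol e x \<and>
        hol e x \<in> G \<and>
        left_polar_decomposition (complexification pb (hol e) C x) S (hol e x)"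
    using complexification_sums[OF x] unfolding Let_def gen left_polar_decomposition_def
    by (auto intro: sums_summable pos_def_hermitian_mat_exp hermitian_generator)
qed

end
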